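(* Let $j,k$ be positive integers with $j=m+1\geq 2$, and let $(f_n)_{n\geq -2}$ be defined by $f_{-2}=1$, $f_{-1}=0$, and $f_n=kf_{n-1}+f_{n-2}$ for $n\geq 0$. Then there exist positive integers $d,e$ such that $$\sqrt{d}=[e,\overline{k,\dots,k,2e}],\quad\text{with period } j,$$ (where $k$ appears $m=j-1$ times in the repeating block) if and only if $k$ is even or $m\not\equiv 2 \pmod 3$. In this case, all such pairs $(d,e)$ are exactly the following: (1) if $k$ is even and $f_m$ is odd: $$e=\frac{k}{2}+\ell f_m,\qquad d=e^2+2\ell f_{m-1}+1,\qquad \ell\in\mathbb{Z},\ \ell\geq 1;$$ (2) if $k$ is even and $f_m$ is even: $$e=\frac{k}{2}+\ell\,\frac{f_m}{2},\qquad d=e^2+\ell f_{m-1}+1,\qquad \ell\in\mathbb{Z},\ \ell\geq 1;$$ (3) if $k$ is odd: $$e=\frac{k+f_m}{2}+\ell f_m,\qquad d=e^2+(2\ell+1)f_{m-1}+1,\qquad \ell\in\mathbb{Z},\ \ell\geq 0.$$ Moreover, for each such pair $(d,e)$, the smallest solution to the equation $X^2-dY^2=(-1)^j$ is $$(x,y)=(f_m e+f_{m-1},\,f_m).$$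
   Context: $[a_0,a_1,a_2,\dots]$ denotes the simple continued fraction with partial quotients $a_0,a_1,a_2,\dots$, and a bar denotes the block that is repeated periodically. If $d$ is a positive integer that is not a perfect square, then $\sqrt d=[e,\overline{a_1,\dots,a_{j-1},2e}]$ with $e=\lfloor\sqrt d\rfloor$ and positive integers $a_i$; "period $j$" means that $j$ is the least period length of the sequence of partial quotients $a_1,a_2,\dots$ (so for $j\ge 2$, the expansion $[e,\overline{k,\dots,k,2e}]$ having period $j$ forces $k\neq 2e$). The smallest solution to $X^2-dY^2=(-1)^j$ means the pair $(x,y)$ of positive integers satisfying $x^2-dy^2=(-1)^j$ for which the real number $x+y\sqrt d$ is smallest among all pairs of positive integers satisfying that equation. *)

theory Defs
  imports Complex_Main
begin

primrec cfrac_conv :: "nat \<Rightarrow> (nat \<Rightarrow> int) \<Rightarrow> real" where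
  "cfrac_conv 0 a = of_int (a 0)"
| "cfrac_conv (Suc n) a = of_int (a 0) + 1 / cfrac_conv n (\<lambda>i. a (Suc i))"

text \<open>\<open>has_cfrac x a\<close> is the equation \<open>x = [a 0, a 1, a 2, ...]\<close> for an infinite simple
  continued fraction.  An infinite expansion forces \<open>x\<close> to be irrational, so
  \<open>has_cfrac (sqrt d) a\<close> already excludes that \<open>d\<close> is a perfect square.\<close>

definition has_cfrac :: "real \<Rightarrow> (nat \<Rightarrow> int) \<Rightarrow> bool" where
  "has_cfrac x a \<longleftrightarrow> (\<forall>i\<ge>1. a i > 0) \<and> (\<lambda>n. cfrac_conv n a) \<longlonglongrightarrow> x"

text \<open>The partial quotients \<open>e, bs, bs, bs, ...\<close>, for a nonempty block \<open>bs\<close>.\<close>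

definition periodic_quotients :: "int \<Rightarrow> int list \<Rightarrow> nat \<Rightarrow> int" where
  "periodic_quotients e bs n = (if n = 0 then e else bs ! ((n - 1) mod length bs))"

text \<open>The initial term \<open>a 0\<close> does not take part in the period.\<close>

definition is_period :: "(nat \<Rightarrow> int) \<Rightarrow> nat \<Rightarrow> bool" where
  "is_period a p \<longleftrightarrow> p > 0 \<and> (\<forall>i\<ge>1. a (i + p) = a i)"

definition is_least_period :: "(nat \<Rightarrow> int) \<Rightarrow> nat \<Rightarrow> bool" where
  "is_least_period a p \<longleftrightarrow> is_period a p \<and> (\<forall>q. is_period a q \<longrightarrow> p \<le> q)"

definition sqrt_expansion :: "nat \<Rightarrow> int \<Rightarrow> int \<Rightarrow> int \<Rightarrow> bool" where
  "sqrt_expansion j k d e \<longleftrightarrow> d > 0 \<and> e > 0 \<and>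
     (let a = periodic_quotients e (replicate (j - 1) k @ [2 * e])
      in has_cfrac (sqrt (of_int d)) a \<and> is_least_period a j)"

definition solves :: "int \<Rightarrow> int \<Rightarrow> int \<Rightarrow> int \<Rightarrow> bool" where
  "solves d c x y \<longleftrightarrow> x > 0 \<and> y > 0 \<and> x\<^sup>2 - d * y\<^sup>2 = c"

definition is_smallest_solution :: "int \<Rightarrow> int \<Rightarrow> int \<Rightarrow> int \<Rightarrow> bool" where
  "is_smallest_solution d c x y \<longleftrightarrow> solves d c x y \<and>
     (\<forall>u v. solves d c u v \<longrightarrow>
        of_int x + of_int y * sqrt (of_int d) \<le> of_int u + of_int v * sqrt (of_int d))"

end

theory Submission
  imports Defs
begin

text \<open>
  Write \<open>F = f m\<close> and \<open>G = f (m - 1)\<close>.  In \<open>sqrt d = [e, k, ..., k, 2e, k, ...]\<close> the tail that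
  starts at the first \<open>2e\<close> is the expansion itself with \<open>e\<close> added to its first entry, so its
  value is \<open>sqrt d + e\<close>.  Hence the expansion holds exactly when
  \<open>sqrt d = [e, k, ..., k, sqrt d + e]\<close>, an equation with finitely many quotients
  (\<open>has_cfrac_block_iff\<close>).  The block of \<open>k\<close>s acts as a Moebius map whose coefficients are
  consecutive values of \<open>f\<close> (\<open>funpow_constant_quotient\<close>).  After clearing denominators the terms
  linear in \<open>sqrt d\<close> cancel, and what remains is the integer equation
  \<open>F (d - e\<^sup>2 - 1) = (2e - k) G\<close> (\<open>Moebius_fixed_point_iff\<close>).

  As \<open>F\<close> and \<open>G\<close> are coprime, this says \<open>2e = k + tF\<close> and \<open>d = e\<^sup>2 + tG + 1\<close> for an integer \<open>t\<close>.
  Here \<open>t = 0\<close> is the case \<open>2e = k\<close>, in which the period drops to 1, and \<open>t < 0\<close> is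
  impossible because \<open>F \<ge> k\<close> and \<open>e > 0\<close>.  So the pairs are parametrised by the \<open>t \<ge> 1\<close> for
  which \<open>k + tF\<close> is even (\<open>sqrt_expansion_iff\<close>).  The cases of the theorem record this parity
  condition; for odd \<open>k\<close> the parity of \<open>f\<close> has period 3, like that of the Fibonacci numbers,
  and a solution exists exactly when \<open>F\<close> is odd.

  That \<open>(Fe + G, F)\<close> has norm \<open>(-1)\<^sup>j\<close> is Cassini's identity for \<open>f\<close>.  Minimality is
  a direct estimate.  If \<open>(x, y)\<close> and \<open>(u, v)\<close> are positive solutions of the
  same norm \<open>1\<close> or \<open>-1\<close> and \<open>v < y\<close>, then \<open>u / v\<close> and \<open>x / y\<close> are both so close to \<open>sqrt d\<close> that
  the integer \<open>uy - vx\<close> has absolute value below 1, provided \<open>y \<le> 2e\<close>; so it vanishes, which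
  gives the contradiction \<open>v = y\<close>.  The bound \<open>y \<le> 2e\<close> is available because \<open>2e = k + tF\<close>
  (\<open>smallest_solution_criterion\<close>).
\<close>

section \<open>Continued fractions and complete quotients\<close>

lemma cfrac_conv_ge_1:
  assumes "\<And>i. a i \<ge> 1"
  shows "cfrac_conv n a \<ge> 1"
  using assms
proof (induction n arbitrary: a)
  case 0
  show ?case using 0[of 0] by simp
next
  case (Suc n)
  have "cfrac_conv n (\<lambda>i. a (Suc i)) \<ge> 1" by (rule Suc.IH) (rule Suc.prems)
  then have "1 / cfrac_conv n (\<lambda>i. a (Suc i)) \<ge> 0" by simp
  moreover have "real_of_int (a 0) \<ge> 1" using Suc.prems[of 0] by simp
  ultimately show ?case unfolding cfrac_conv.simps by linarith
qed

lemma cfrac_conv_add: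
  "cfrac_conv n (a(0 := a 0 + c)) = cfrac_conv n a + of_int c"
  by (cases n) simp_all

lemma has_cfrac_add:
  assumes "has_cfrac x a"
  shows "has_cfrac (x + of_int c) (a(0 := a 0 + c))"
  using assms unfolding has_cfrac_def cfrac_conv_add
  by (auto intro: tendsto_add)

lemma has_cfrac_unique:
  "has_cfrac x a \<Longrightarrow> has_cfrac y a \<Longrightarrow> x = y"
  unfolding has_cfrac_def using LIMSEQ_unique by blast

text \<open>The approximants of the tail lie in \<open>[1, a 1 + 1]\<close>.  The upper bound keeps their reciprocals
  away from 0, so the limit \<open>x - a 0\<close> of the reciprocals is positive and can be inverted.\<close>

lemma has_cfrac_tail:
  assumes "has_cfrac x a"
  shows "x > of_int (a 0)" and "has_cfrac (1 / (x - of_int (a 0))) (\<lambda>i. a (Suc i))"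
proof -
  define c where "c n = cfrac_conv n (\<lambda>i. a (Suc i))" for n
  have pos: "a (Suc i) \<ge> 1" for i
  proof -
    have "a (Suc i) > 0" using assms unfolding has_cfrac_def by simp
    then show ?thesis by simp
  qed
  have c1: "c n \<ge> 1" for n unfolding c_def using pos by (intro cfrac_conv_ge_1)
  have upper: "c n \<le> of_int (a 1) + 1" for n
  proof (cases n)
    case (Suc n')
    have "cfrac_conv n' (\<lambda>i. a (Suc (Suc i))) \<ge> 1" using pos by (intro cfrac_conv_ge_1)
    then show ?thesis unfolding c_def Suc by simp
  qed (simp add: c_def)
  have "(\<lambda>n. cfrac_conv (Suc n) a) \<longlonglongrightarrow> x"
    using assms unfolding has_cfrac_def by (intro LIMSEQ_Suc) simp
  then have "(\<lambda>n. of_int (a 0) + 1 / c n) \<longlonglongrightarrow> x" by (simp add: c_def)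
  from tendsto_diff[OF this tendsto_const[of "of_int (a 0)"]]
  have lim: "(\<lambda>n. 1 / c n) \<longlonglongrightarrow> x - of_int (a 0)" by simp
  have lower: "1 / c n \<ge> 1 / (of_int (a 1) + 1)" for n
    using upper[of n] c1[of n] by (intro divide_left_mono) (auto intro!: mult_pos_pos)
  have "x - of_int (a 0) \<ge> 1 / (of_int (a 1) + 1)"
    by (rule LIMSEQ_le_const[OF lim]) (use lower in blast)
  moreover have "1 / (real_of_int (a 1) + 1) > 0" using pos[of 0] by simp
  ultimately show gt: "x > of_int (a 0)" by linarith
  have "(\<lambda>n. 1 / (1 / c n)) \<longlonglongrightarrow> 1 / (x - of_int (a 0))"
    using gt by (intro tendsto_divide lim tendsto_const) simp
  then show "has_cfrac (1 / (x - of_int (a 0))) (\<lambda>i. a (Suc i))"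
    unfolding has_cfrac_def using pos by (auto simp: c_def intro: less_le_trans[OF zero_less_one])
qed

lemma has_cfrac_constant_prefix:
  assumes "has_cfrac x a" and "\<And>i. i < r \<Longrightarrow> a i = k" and "has_cfrac z (\<lambda>n. a (n + r))"
  shows "x = ((\<lambda>y. of_int k + 1 / y) ^^ r) z"
  using assms
proof (induction r arbitrary: x a)
  case 0
  then show ?case using has_cfrac_unique by simp
next
  case (Suc r)
  have "1 / (x - of_int (a 0)) = ((\<lambda>y. of_int k + 1 / y) ^^ r) z"
    using Suc.prems by (intro Suc.IH[OF has_cfrac_tail(2)[OF Suc.prems(1)]]) auto
  moreover have "x = of_int (a 0) + 1 / (1 / (x - of_int (a 0)))" by simp
  moreover have "a 0 = k" using Suc.prems by simp
  ultimately show ?case by simp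
qed

text \<open>Numbers that behave like complete quotients force convergence.  Two steps of the expansion
  shrink the error by a factor of at least 4, because the product of two consecutive complete
  quotients, as well as that of two consecutive approximants, is of the form \<open>b u + 1\<close> with
  \<open>b, u \<ge> 1\<close>.\<close>

lemma complete_quotients_imp_has_cfrac:
  fixes X :: "nat \<Rightarrow> real"
  assumes "\<And>i. a (Suc i) \<ge> 1" and "\<And>i. X (Suc i) \<ge> 1"
    and "\<And>i. X i = of_int (a i) + 1 / X (Suc i)"
  shows "has_cfrac (X 0) a"
proof -
  have bound: "\<bar>cfrac_conv n a - X 0\<bar> \<le> 2 * (1 / 2) ^ n"
    if "\<And>i. a (Suc i) \<ge> 1" and "\<And>i. X (Suc i) \<ge> 1"
      and "\<And>i. X i = of_int (a i) + 1 / X (Suc i)" for n a and X :: "nat \<Rightarrow> real"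
    using that
  proof (induction n arbitrary: a X rule: less_induct)
    case (less n)
    have X1: "0 \<le> 1 / X (Suc i)" "1 / X (Suc i) \<le> 1" for i
      using less.prems(2)[of i] by auto
    have X0: "X 0 = of_int (a 0) + 1 / X (Suc 0)" by (rule less.prems(3))
    consider "n = 0" | "n = 1" | n' where "n = Suc (Suc n')"
      by (metis One_nat_def not0_implies_Suc)
    then show ?case
    proof cases
      case 1
      then show ?thesis using X0 X1[of 0] by simp
    next
      case 2
      have "0 \<le> 1 / real_of_int (a 1)" "1 / real_of_int (a 1) \<le> 1"
        using less.prems(1)[of 0] by auto
      moreover have "cfrac_conv n a - X 0 = 1 / real_of_int (a 1) - 1 / X (Suc 0)"
        using X0 2 by simp
      moreover have "2 * (1 / 2 :: real) ^ n = 1" using 2 by simp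
      ultimately show ?thesis using X1[of 0] by linarith
    next
      case 3
      define u where "u = cfrac_conv n' (\<lambda>i. a (Suc (Suc i)))"
      define v where "v = X (Suc (Suc 0))"
      have u: "u \<ge> 1" unfolding u_def by (rule cfrac_conv_ge_1) (rule less.prems(1))
      have v: "v \<ge> 1" unfolding v_def by (rule less.prems(2))
      have IH: "\<bar>u - v\<bar> \<le> 2 * (1 / 2) ^ n'"
        unfolding u_def v_def
        by (rule less.IH[of n' "\<lambda>i. a (Suc (Suc i))" "\<lambda>i. X (Suc (Suc i))"]) 
           (simp add: 3, rule less.prems(1), rule less.prems(2), rule less.prems(3))
      define b where "b = real_of_int (a (Suc 0))"
      have b: "b \<ge> 1" using less.prems(1)[of 0] by (simp add: b_def)
      have bu: "b * u + 1 \<ge> 2" "b * v + 1 \<ge> 2"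
        using mult_mono[OF b u] mult_mono[OF b v] b by auto
      have "X (Suc 0) = b + 1 / v" using less.prems(3)[of "Suc 0"] by (simp add: b_def v_def)
      then have "cfrac_conv n a - X 0 = 1 / (b + 1 / u) - 1 / (b + 1 / v)"
        using X0 by (simp add: 3 u_def b_def)
      also have "\<dots> = u / (b * u + 1) - v / (b * v + 1)"
        using u v by (simp add: field_simps)
      also have "\<dots> = (u - v) / ((b * u + 1) * (b * v + 1))"
        using bu by (simp add: field_simps)
      finally have "\<bar>cfrac_conv n a - X 0\<bar> = \<bar>u - v\<bar> / ((b * u + 1) * (b * v + 1))"
        using bu by (simp add: abs_mult)
      also have "\<dots> \<le> (2 * (1 / 2) ^ n') / 4"
        using IH mult_mono[OF bu] bu by (intro frac_le) auto
      also have "\<dots> = 2 * (1 / 2) ^ n" by (simp add: 3)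
      finally show ?thesis .
    qed
  qed
  have "(\<lambda>n. cfrac_conv n a - X 0) \<longlonglongrightarrow> 0"
  proof (rule tendsto_rabs_zero_cancel,
      rule tendsto_sandwich[where f = "\<lambda>_. 0" and h = "\<lambda>n. 2 * (1 / 2) ^ n"])
    show "(\<lambda>n. 2 * (1 / 2 :: real) ^ n) \<longlonglongrightarrow> 0"
      by (intro tendsto_mult_right_zero LIMSEQ_power_zero) simp
  qed (use bound[of a X, OF assms] in auto)
  then have "(\<lambda>n. cfrac_conv n a) \<longlonglongrightarrow> X 0" by (simp add: LIM_zero_iff)
  moreover have "a i > 0" if "i \<ge> 1" for i
    using assms(1)[of "i - 1"] that by simp
  ultimately show ?thesis unfolding has_cfrac_def by blast
qed

section \<open>The continuants of a constant block\<close>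

text \<open>The sequence \<open>f\<close> of the theorem, shifted so that it starts at 0 on the natural numbers:
  \<open>kfib k n = f (n - 1)\<close>.  The value \<open>f (n - 2)\<close> is then
  \<open>kfib k (n + 1) - k * kfib k n\<close>, which makes sense for \<open>n = 0\<close> too.\<close>

fun kfib :: "int \<Rightarrow> nat \<Rightarrow> int" where
  "kfib k 0 = 0"
| "kfib k (Suc 0) = 1"
| "kfib k (Suc (Suc n)) = k * kfib k (Suc n) + kfib k n"

lemma kfib_nonneg: "k > 0 \<Longrightarrow> kfib k n \<ge> 0"
  by (induction k n rule: kfib.induct) auto

lemma kfib_Suc_pos: "k > 0 \<Longrightarrow> kfib k (Suc n) > 0"
  by (induction n) (auto intro!: add_pos_nonneg kfib_nonneg)

lemma kfib_ge:
  assumes "k > 0"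
  shows "kfib k (Suc (Suc n)) \<ge> k"
proof -
  have "k * 1 \<le> k * kfib k (Suc n)"
    using kfib_Suc_pos[OF assms, of n] assms by (intro mult_left_mono) auto
  then show ?thesis using kfib_nonneg[OF assms, of n] by simp
qed

text \<open>Cassini's identity \<open>f (n - 1)\<^sup>2 - f n f (n - 2) = (-1)\<^bsup>n + 1\<^esup>\<close>, with \<open>f (n - 2)\<close> eliminated.\<close>

lemma kfib_cassini:
  "(kfib k n)\<^sup>2 + k * kfib k n * kfib k (Suc n) - (kfib k (Suc n))\<^sup>2 = (-1) ^ Suc n"
proof (induction n)
  case (Suc n)
  have "(kfib k (Suc n))\<^sup>2 + k * kfib k (Suc n) * kfib k (Suc (Suc n)) - (kfib k (Suc (Suc n)))\<^sup>2
      = - ((kfib k n)\<^sup>2 + k * kfib k n * kfib k (Suc n) - (kfib k (Suc n))\<^sup>2)"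
    by (simp add: algebra_simps power2_eq_square)
  then show ?case unfolding Suc.IH by simp
qed simp

lemma coprime_kfib_Suc: "coprime (kfib k (Suc n)) (kfib k n)"
proof (induction n)
  case (Suc n)
  have "coprime (kfib k n + k * kfib k (Suc n)) (kfib k (Suc n))"
    using Suc by (metis coprime_commute gcd_add_mult coprime_iff_gcd_eq_1 add.commute mult.commute)
  then show ?case by (simp add: add.commute)
qed simp

lemma even_kfib_iff:
  assumes "odd k"
  shows "even (kfib k n) \<longleftrightarrow> n mod 3 = 0"
proof (induction n rule: induct_nat_012)
  case (ge2 n)
  have "even (kfib k (Suc (Suc n))) \<longleftrightarrow> (even (kfib k (Suc n)) \<longleftrightarrow> even (kfib k n))"
    using assms by simp
  also have "\<dots> \<longleftrightarrow> (Suc n mod 3 = 0 \<longleftrightarrow> n mod 3 = 0)" unfolding ge2 ..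
  also have "\<dots> \<longleftrightarrow> Suc (Suc n) mod 3 = 0" by presburger
  finally show ?case .
qed simp_all

text \<open>The value of \<open>[k, ..., k, z]\<close> with \<open>r\<close> leading \<open>k\<close>s, in terms of the continuants.\<close>

lemma funpow_constant_quotient:
  fixes z :: real
  assumes "k > 0" and "z > 0"
  shows "((\<lambda>y. of_int k + 1 / y) ^^ r) z =
    (of_int (kfib k (Suc r)) * z + of_int (kfib k r))
      / (of_int (kfib k r) * z + of_int (kfib k (Suc r) - k * kfib k r))"
proof (induction r)
  case (Suc r)
  let ?N = "of_int (kfib k (Suc r)) * z + of_int (kfib k r)"
  have "?N > 0" using assms kfib_Suc_pos[of k r] kfib_nonneg[of k r]
    by (intro add_pos_nonneg) auto
  then show ?case using Suc by (simp add: field_simps)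
qed simp

section \<open>Expansions of square roots as a Diophantine condition\<close>

lemma periodic_quotients_block:
  "periodic_quotients e (replicate m k @ [b]) n =
    (if n = 0 then e else if (n - 1) mod Suc m < m then k else b)"
proof (cases "(n - 1) mod Suc m < m")
  case False
  then have "(n - 1) mod Suc m = m" using mod_less_divisor[of "Suc m" "n - 1"] by linarith
  then show ?thesis by (simp add: periodic_quotients_def nth_append)
qed (simp add: periodic_quotients_def nth_append)

text \<open>If \<open>b \<noteq> k\<close>, a period must carry one occurrence of \<open>b\<close> to another, and consecutive
  occurrences are \<open>m + 1\<close> apart.  If \<open>b = k\<close>, the periodic part is constant.\<close>

lemma is_least_period_block:
  assumes "m \<ge> 1"
  shows "is_least_period (periodic_quotients e (replicate m k @ [b])) (Suc m) \<longleftrightarrow> b \<noteq> k"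
proof -
  let ?a = "periodic_quotients e (replicate m k @ [b])"
  have per: "is_period ?a (Suc m)"
    unfolding is_period_def periodic_quotients_block
  proof (intro conjI allI impI)
    fix i :: nat assume "i \<ge> 1"
    then have "(i + Suc m - 1) = (i - 1) + Suc m" by simp
    then show "(if i + Suc m = 0 then e else if (i + Suc m - 1) mod Suc m < m then k else b)
      = (if i = 0 then e else if (i - 1) mod Suc m < m then k else b)"
      using \<open>i \<ge> 1\<close> by (simp only: mod_add_self2) simp
  qed simp
  show ?thesis
  proof
    assume L: "is_least_period ?a (Suc m)"
    show "b \<noteq> k"
    proof
      assume "b = k"
      then have "is_period ?a 1" unfolding is_period_def periodic_quotients_block by simp
      with L have "Suc m \<le> 1" unfolding is_least_period_def by blast
      with assms show False by simp
    qed
  next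
    assume bk: "b \<noteq> k"
    have "Suc m \<le> q" if q: "is_period ?a q" for q
    proof -
      have "\<forall>i\<ge>1. ?a (i + q) = ?a i" using q unfolding is_period_def by blast
      then have "?a (Suc m + q) = ?a (Suc m)" by (elim allE[of _ "Suc m"]) simp
      then have "\<not> (m + q) mod Suc m < m"
        using bk unfolding periodic_quotients_block by (simp split: if_splits)
      moreover have "q > 0" using q unfolding is_period_def by simp
      moreover have "(m + q) mod Suc m = q - 1" if "q \<le> m" "q > 0"
      proof -
        have "m + q = (q - 1) + Suc m" using that by simp
        then have "(m + q) mod Suc m = (q - 1) mod Suc m" by (metis mod_add_self2)
        then show ?thesis using that by simp
      qed
      ultimately show ?thesis by (cases "q \<le> m") auto
    qed
    then show "is_least_period ?a (Suc m)" using per unfolding is_least_period_def by blast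
  qed
qed

text \<open>With \<open>s = sqrt d\<close> the left-hand side becomes
  \<open>(s - e) (F (s + e) + G) = G (s + e) + F - kG\<close>.  The term \<open>G s\<close> occurs on both sides
  and cancels; the only other occurrence of \<open>s\<close> is \<open>s\<^sup>2 = d\<close>.\<close>

lemma Moebius_fixed_point_iff:
  fixes F G k d e :: int
  assumes "F > 0" "G > 0" "F \<ge> k * G" "d > 0" "e > 0"
  shows "sqrt (of_int d) = of_int e + 1 / ((of_int F * (sqrt (of_int d) + of_int e) + of_int G)
      / (of_int G * (sqrt (of_int d) + of_int e) + of_int (F - k * G)))
    \<longleftrightarrow> F * (d - e\<^sup>2 - 1) = (2 * e - k) * G"
proof -
  define s where "s = sqrt (real_of_int d)"
  have s: "s > 0" "s * s = of_int d" using assms by (auto simp: s_def)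
  have N: "of_int F * (s + of_int e) + of_int G > 0"
    using assms s by (intro add_pos_pos mult_pos_pos) auto
  have "s = of_int e + 1 / ((of_int F * (s + of_int e) + of_int G)
      / (of_int G * (s + of_int e) + of_int (F - k * G)))
    \<longleftrightarrow> (s - of_int e) * (of_int F * (s + of_int e) + of_int G) =
       of_int G * (s + of_int e) + of_int (F - k * G)"
    using N by (auto simp: field_simps)
  also have "\<dots> \<longleftrightarrow> of_int F * (s * s - of_int (e\<^sup>2) - 1) = of_int ((2 * e - k) * G)"
    by (simp add: algebra_simps power2_eq_square)
  also have "\<dots> \<longleftrightarrow> real_of_int (F * (d - e\<^sup>2 - 1)) = of_int ((2 * e - k) * G)"
    unfolding s by simp
  also have "\<dots> \<longleftrightarrow> F * (d - e\<^sup>2 - 1) = (2 * e - k) * G" by (simp only: of_int_eq_iff)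
  finally show ?thesis unfolding s_def .
qed

text \<open>From left to right, the tail after \<open>m + 1\<close> quotients is the original sequence with its
  first entry \<open>e\<close> replaced by \<open>2e\<close>, hence the expansion of \<open>sqrt d + e\<close>.  From right to left,
  the finite equation makes the values \<open>[k, ..., k, sqrt d + e]\<close> a cyclic family of complete
  quotients.\<close>

lemma has_cfrac_block_iff:
  fixes k d e :: int
  assumes "k > 0" "d > 0" "e > 0"
  shows "has_cfrac (sqrt (of_int d)) (periodic_quotients e (replicate m k @ [2 * e])) \<longleftrightarrow>
    sqrt (of_int d) = of_int e + 1 / ((\<lambda>y. of_int k + 1 / y) ^^ m) (sqrt (of_int d) + of_int e)"
    (is "has_cfrac ?s ?a \<longleftrightarrow> ?s = of_int e + 1 / (?T ^^ m) ?\<alpha>")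
proof
  assume cf: "has_cfrac ?s ?a"
  have "(\<lambda>n. ?a (Suc (n + m))) = ?a(0 := ?a 0 + e)"
  proof
    fix n
    show "?a (Suc (n + m)) = (?a(0 := ?a 0 + e)) n"
    proof (cases n)
      case (Suc n')
      have "(n + m) mod Suc m = n' mod Suc m"
        using mod_add_self2[of n' "Suc m"] by (simp add: Suc)
      then show ?thesis by (simp add: periodic_quotients_block Suc del: mod_Suc)
    qed (simp add: periodic_quotients_block)
  qed
  then have "has_cfrac ?\<alpha> (\<lambda>n. ?a (Suc (n + m)))"
    using has_cfrac_add[OF cf, of e] by simp
  then have "1 / (?s - of_int e) = (?T ^^ m) ?\<alpha>"
    using has_cfrac_tail(2)[OF cf]
    by (intro has_cfrac_constant_prefix[where a = "\<lambda>i. ?a (Suc i)"])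
       (simp_all add: periodic_quotients_block)
  then show "?s = of_int e + 1 / (?T ^^ m) ?\<alpha>" 
    by (simp flip: \<open>1 / (?s - of_int e) = (?T ^^ m) ?\<alpha>\<close>)
next
  assume eq: "?s = of_int e + 1 / (?T ^^ m) ?\<alpha>"
  \<comment> \<open>The periodic part is numbered from \<open>i = 1\<close>, so the complete quotient at \<open>i\<close> has
    \<open>(i - 1) mod Suc m\<close> of the \<open>m\<close> copies of \<open>k\<close> behind it and the others still ahead.\<close>
  define X where "X i = (if i = 0 then ?s else (?T ^^ (m - (i - 1) mod Suc m)) ?\<alpha>)" for i
  have T: "(?T ^^ r) ?\<alpha> \<ge> 1" for r
  proof (induction r)
    case 0
    have "real_of_int e \<ge> 1" "?s \<ge> 0" using assms by auto
    then show ?case unfolding funpow_0 by linarith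
  next
    case (Suc r)
    then have "1 / (?T ^^ r) ?\<alpha> \<ge> 0" by simp
    moreover have "real_of_int k \<ge> 1" using assms by simp
    ultimately show ?case unfolding funpow.simps comp_apply by linarith
  qed
  have "has_cfrac (X 0) ?a"
  proof (rule complete_quotients_imp_has_cfrac)
    fix i
    show "?a (Suc i) \<ge> 1" using assms by (simp add: periodic_quotients_block)
    show "X (Suc i) \<ge> 1" using T by (simp add: X_def)
    show "X i = of_int (?a i) + 1 / X (Suc i)"
    proof (cases i)
      case 0
      then show ?thesis using eq by (simp add: X_def periodic_quotients_block)
    next
      case (Suc n)
      show ?thesis
      proof (cases "n mod Suc m < m")
        case True
        then have "Suc n mod Suc m = Suc (n mod Suc m)" by (simp add: mod_Suc)
        moreover have "m - n mod Suc m = Suc (m - Suc (n mod Suc m))" using True by simp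
        ultimately show ?thesis using True
          by (simp add: X_def periodic_quotients_block Suc)
      next
        case False
        then have n: "n mod Suc m = m"
          using mod_less_divisor[of "Suc m" n] by linarith
        then have "Suc n mod Suc m = 0" by (simp add: mod_Suc)
        then show ?thesis using n eq
          by (simp add: X_def periodic_quotients_block Suc)
      qed
    qed
  qed
  then show "has_cfrac ?s ?a" by (simp add: X_def)
qed

lemma sqrt_expansion_iff:
  fixes k d e :: int
  assumes k: "k > 0" and m: "m \<ge> 1"
  shows "sqrt_expansion (Suc m) k d e \<longleftrightarrow>
    (\<exists>t\<ge>1. 2 * e = k + t * kfib k (Suc m) \<and> d = e\<^sup>2 + t * kfib k m + 1)"
proof -
  obtain n where n: "m = Suc n" using m by (cases m) auto
  define F where "F = kfib k (Suc m)"
  define G where "G = kfib k m"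
  have F: "F > 0" "F \<ge> k" using kfib_Suc_pos[OF k, of m] kfib_ge[OF k, of n] by (simp_all add: F_def n)
  have G: "G > 0" using kfib_Suc_pos[OF k, of n] by (simp add: G_def n)
  have FG: "F \<ge> k * G" using kfib_nonneg[OF k, of n] by (simp add: F_def G_def n)
  have "coprime F G" unfolding F_def G_def by (rule coprime_kfib_Suc)
  have "sqrt_expansion (Suc m) k d e \<longleftrightarrow>
      d > 0 \<and> e > 0 \<and> F * (d - e\<^sup>2 - 1) = (2 * e - k) * G \<and> 2 * e \<noteq> k"
  proof (cases "d > 0 \<and> e > 0")
    case True
    then have "sqrt (of_int d) + real_of_int e > 0" by (intro add_nonneg_pos) auto
    then have "has_cfrac (sqrt (of_int d)) (periodic_quotients e (replicate m k @ [2 * e])) \<longleftrightarrow>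
        F * (d - e\<^sup>2 - 1) = (2 * e - k) * G"
      using True k F G FG
      by (subst has_cfrac_block_iff, simp_all only: funpow_constant_quotient flip: F_def G_def)
         (subst Moebius_fixed_point_iff, simp_all)
    then show ?thesis
      using True is_least_period_block[OF m, of e k "2 * e"]
      by (simp add: sqrt_expansion_def Let_def)
  qed (auto simp: sqrt_expansion_def)
  also have "\<dots> \<longleftrightarrow> (\<exists>t\<ge>1. 2 * e = k + t * F \<and> d = e\<^sup>2 + t * G + 1)"
  proof
    assume *: "d > 0 \<and> e > 0 \<and> F * (d - e\<^sup>2 - 1) = (2 * e - k) * G \<and> 2 * e \<noteq> k"
    then have "F dvd (2 * e - k) * G" by (metis dvd_triv_left)
    then have "F dvd 2 * e - k" using \<open>coprime F G\<close> by (simp add: coprime_dvd_mult_left_iff)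
    then obtain t where t: "2 * e - k = F * t" ..
    have "F * (d - e\<^sup>2 - 1) = F * (t * G)" using * t by (simp add: ac_simps)
    then have "d - e\<^sup>2 - 1 = t * G" using F by simp
    moreover have "t \<ge> 1"
    proof (rule ccontr)
      assume "\<not> t \<ge> 1"
      moreover have "t \<noteq> 0" using t * by auto
      ultimately have "t \<le> -1" by simp
      then have "F * t \<le> F * (-1)" using F by (intro mult_left_mono) auto
      then show False using t * F by linarith
    qed
    ultimately show "\<exists>t\<ge>1. 2 * e = k + t * F \<and> d = e\<^sup>2 + t * G + 1"
      using t by (intro exI[of _ t]) (auto simp: algebra_simps)
  next
    assume "\<exists>t\<ge>1. 2 * e = k + t * F \<and> d = e\<^sup>2 + t * G + 1"
    then obtain t where t: "t \<ge> 1" "2 * e = k + t * F" "d = e\<^sup>2 + t * G + 1" by blast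
    have "t * F > 0" "t * G > 0" using t F G by auto
    then show "d > 0 \<and> e > 0 \<and> F * (d - e\<^sup>2 - 1) = (2 * e - k) * G \<and> 2 * e \<noteq> k"
      using t k by (auto simp: algebra_simps intro: add_pos_nonneg)
  qed
  finally show ?thesis unfolding F_def G_def .
qed

section \<open>The smallest solution\<close>

text \<open>Let \<open>s = sqrt d\<close>, \<open>P = u + v s\<close>, \<open>Q = x + y s\<close>.  As \<open>u - v s = c / P\<close> and
  \<open>x - y s = c / Q\<close>, the integer \<open>u y - v x\<close> equals \<open>c (y / P - v / Q)\<close>.  If \<open>v < y\<close>, both
  fractions lie strictly between 0 and 1: the first since \<open>P > 2e \<ge> y\<close>, the second since
  \<open>Q > y > v\<close>.  A common sign \<open>c\<close> makes this a difference of the two fractions and not a sum.\<close>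

lemma smallest_solution_criterion:
  assumes sol: "solves d c x y" and c: "\<bar>c\<bar> = 1" and "d > e\<^sup>2" "y \<le> 2 * e"
  shows "is_smallest_solution d c x y"
  unfolding is_smallest_solution_def
proof (intro conjI allI impI sol)
  fix u v assume uv: "solves d c u v"
  define s where "s = sqrt (real_of_int d)"
  have pos: "x > 0" "y > 0" "u > 0" "v > 0" using sol uv by (auto simp: solves_def)
  have xy: "x\<^sup>2 = d * y\<^sup>2 + c" and u2: "u\<^sup>2 = d * v\<^sup>2 + c" using sol uv by (auto simp: solves_def)
  have "d > 0" using \<open>d > e\<^sup>2\<close> zero_le_power2[of e] by linarith
  have s: "s * s = of_int d" "s > of_int e"
  proof -
    show "s * s = of_int d" using \<open>d > 0\<close> by (simp add: s_def)
    have "real_of_int (e\<^sup>2) < of_int d" using \<open>d > e\<^sup>2\<close> by (simp only: of_int_less_iff)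
    then show "s > of_int e" unfolding s_def by (intro real_less_rsqrt) simp
  qed
  have spos: "s \<ge> 1" using \<open>d > 0\<close> by (simp add: s_def)
  have "y \<le> v"
  proof (rule ccontr)
    assume "\<not> y \<le> v"
    then have "v < y" by simp
    have "d * 1 \<le> d * v\<^sup>2" using \<open>d > 0\<close> pos by (intro mult_left_mono) (simp_all add: one_le_power)
    then have "e\<^sup>2 \<le> u\<^sup>2" using u2 c \<open>d > e\<^sup>2\<close> by linarith
    then have "e \<le> u" using pos by (simp add: power2_le_iff_abs_le)
    define P where "P = of_int u + of_int v * s"
    define Q where "Q = of_int x + of_int y * s"
    have "1 * s \<le> of_int v * s" using pos spos by (intro mult_right_mono) auto
    moreover have "real_of_int y \<le> 2 * of_int e" using \<open>y \<le> 2 * e\<close> by linarith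
    ultimately have P: "P > of_int y" using s \<open>e \<le> u\<close> unfolding P_def by linarith
    have "1 * of_int y \<le> real_of_int y * s"
      using pos spos by (subst mult.commute) (intro mult_left_mono, auto)
    then have Q: "Q > of_int v" using \<open>v < y\<close> pos unfolding Q_def by linarith
    have PQ0: "P > 0" "Q > 0" using P Q pos by linarith+
    have cP: "of_int u - of_int v * s = of_int c / P"
      using PQ0 s(1) arg_cong[OF u2, of real_of_int]
      by (simp add: P_def field_simps power2_eq_square)
    have cQ: "of_int x - of_int y * s = of_int c / Q"
      using PQ0 s(1) arg_cong[OF xy, of real_of_int]
      by (simp add: Q_def field_simps power2_eq_square)
    have "real_of_int (u * y - v * x) = of_int y * (of_int u - of_int v * s) - of_int v * (of_int x - of_int y * s)"
      by (simp add: algebra_simps)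
    also have "\<dots> = of_int c * (of_int y / P - of_int v / Q)" unfolding cP cQ by (simp add: algebra_simps)
    finally have "\<bar>real_of_int (u * y - v * x)\<bar> = \<bar>real_of_int c\<bar> * \<bar>of_int y / P - of_int v / Q\<bar>"
      by (simp only: abs_mult)
    moreover have "\<bar>real_of_int c\<bar> = 1" using c by linarith
    moreover have "0 < of_int y / P" "of_int y / P < 1" "0 < of_int v / Q" "of_int v / Q < 1"
      using pos P Q PQ0 by auto
    ultimately have "\<bar>real_of_int (u * y - v * x)\<bar> < 1" by simp
    then have "u * y = v * x" by linarith
    then have "u\<^sup>2 * y\<^sup>2 = v\<^sup>2 * x\<^sup>2" by (metis power_mult_distrib)
    \<comment> \<open>Proportional solutions of the same norm coincide.\<close>
    then have "c * y\<^sup>2 = c * v\<^sup>2" unfolding u2 xy by (simp add: algebra_simps)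
    then have "y\<^sup>2 = v\<^sup>2" using c by auto
    then show False using pos \<open>v < y\<close> by (simp add: power2_eq_iff)
  qed
  then have "y\<^sup>2 \<le> v\<^sup>2" using pos by (intro power_mono) auto
  then have "x\<^sup>2 \<le> u\<^sup>2" unfolding xy u2 using \<open>d > 0\<close> by simp
  then have "x \<le> u" using pos by (simp add: power2_le_iff_abs_le)
  then show "of_int x + of_int y * sqrt (of_int d) \<le> of_int u + of_int v * sqrt (of_int d)"
    using \<open>y \<le> v\<close> spos unfolding s_def by (intro add_mono mult_right_mono) auto
qed

lemma sqrt_expansion_smallest_solution:
  fixes k d e :: int
  assumes "k > 0" and "m \<ge> 1" and "sqrt_expansion (Suc m) k d e"
  shows "is_smallest_solution d ((-1) ^ Suc m) (kfib k (Suc m) * e + kfib k m) (kfib k (Suc m))"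
proof -
  obtain t where t: "t \<ge> 1" "2 * e = k + t * kfib k (Suc m)" "d = e\<^sup>2 + t * kfib k m + 1"
    using assms sqrt_expansion_iff by blast
  define F where "F = kfib k (Suc m)"
  define G where "G = kfib k m"
  have e: "e > 0" using assms(3) by (simp add: sqrt_expansion_def)
  have F: "F > 0" and G: "G \<ge> 0"
    using kfib_Suc_pos[OF assms(1)] kfib_nonneg[OF assms(1)] by (simp_all add: F_def G_def)
  have "(F * e + G)\<^sup>2 - d * F\<^sup>2 = G\<^sup>2 + (2 * e) * F * G - t * G * F\<^sup>2 - F\<^sup>2"
    unfolding t(3)[folded F_def G_def] by (simp add: algebra_simps power2_eq_square)
  also have "\<dots> = G\<^sup>2 + k * G * F - F\<^sup>2"
    unfolding t(2)[folded F_def G_def] by (simp add: algebra_simps power2_eq_square)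
  also have "\<dots> = (-1) ^ Suc m" unfolding F_def G_def by (rule kfib_cassini)
  finally have norm: "(F * e + G)\<^sup>2 - d * F\<^sup>2 = (-1) ^ Suc m" .
  have "F * e > 0" using F e by simp
  show ?thesis
    unfolding F_def[symmetric] G_def[symmetric]
  proof (rule smallest_solution_criterion[where e = e])
    show "solves d ((-1) ^ Suc m) (F * e + G) F"
      using norm F G \<open>F * e > 0\<close> by (simp add: solves_def)
    show "d > e\<^sup>2" using t G by (simp add: G_def add_nonneg_pos)
    have "1 * F \<le> t * F" using t F by (intro mult_right_mono) auto
    then show "F \<le> 2 * e" using t assms(1) by (simp add: F_def)
  qed (simp add: power_abs)
qed

theorem mainTheorem1:
  fixes j m :: nat and k :: int and f :: "int \<Rightarrow> int"
  assumes "k > 0" and "j = m + 1" and "j \<ge> 2"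
    and "f (-2) = 1" and "f (-1) = 0"
    and "\<And>n. n \<ge> 0 \<Longrightarrow> f n = k * f (n - 1) + f (n - 2)"
  shows "((\<exists>d e. sqrt_expansion j k d e) \<longleftrightarrow> even k \<or> m mod 3 \<noteq> 2)
    \<and> (even k \<and> odd (f (int m)) \<longrightarrow>
        (\<forall>d e. sqrt_expansion j k d e \<longleftrightarrow>
          (\<exists>l\<ge>1. e = k div 2 + l * f (int m) \<and>
                d = e\<^sup>2 + 2 * l * f (int m - 1) + 1)))
    \<and> (even k \<and> even (f (int m)) \<longrightarrow>
        (\<forall>d e. sqrt_expansion j k d e \<longleftrightarrow>
          (\<exists>l\<ge>1. e = k div 2 + l * (f (int m) div 2) \<and>
                d = e\<^sup>2 + l * f (int m - 1) + 1)))
    \<and> (odd k \<and> m mod 3 \<noteq> 2 \<longrightarrow>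
        (\<forall>d e. sqrt_expansion j k d e \<longleftrightarrow>
          (\<exists>l\<ge>0. e = (k + f (int m)) div 2 + l * f (int m) \<and>
                d = e\<^sup>2 + (2 * l + 1) * f (int m - 1) + 1)))
    \<and> (\<forall>d e. sqrt_expansion j k d e \<longrightarrow>
        is_smallest_solution d ((-1) ^ j) (f (int m) * e + f (int m - 1)) (f (int m)))"
proof -
  have j: "j = Suc m" and m: "m \<ge> 1" using assms(2,3) by simp_all
  have kfib: "f (int i - 1) = kfib k i" for i
  proof (induction i rule: induct_nat_012)
    case (ge2 n)
    have "f (int n + 1) = k * f (int n) + f (int n - 1)" using assms(6)[of "int n + 1"] by simp
    then show ?case using ge2 by (simp add: add.commute)
  next
    case 1
    then show ?case using assms(4,5) assms(6)[of 0] by simp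
  qed (use assms(5) in simp)
  define F where "F = f (int m)"
  define G where "G = f (int m - 1)"
  have F: "F = kfib k (Suc m)" using kfib[of "Suc m"] by (simp add: F_def)
  have G: "G = kfib k m" using kfib[of m] by (simp add: G_def)
  have expansion: "sqrt_expansion j k d e \<longleftrightarrow> (\<exists>t\<ge>1. 2 * e = k + t * F \<and> d = e\<^sup>2 + t * G + 1)" for d e
    unfolding j F G by (rule sqrt_expansion_iff[OF assms(1) m])
  have parity: "even F \<longleftrightarrow> m mod 3 = 2" if "odd k"
    unfolding F even_kfib_iff[OF that] by presburger
  \<comment> \<open>For even \<open>k\<close> the choice \<open>t = 2\<close> always works; for odd \<open>k\<close> both \<open>t\<close> and \<open>F\<close> must be odd.\<close>
  have A: "(\<exists>d e. sqrt_expansion j k d e) \<longleftrightarrow> even k \<or> m mod 3 \<noteq> 2"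
  proof
    assume "\<exists>d e. sqrt_expansion j k d e"
    then obtain e t where "2 * e = k + t * F" unfolding expansion by blast
    then have "even (k + t * F)" by (metis dvd_triv_left)
    then show "even k \<or> m mod 3 \<noteq> 2" using parity by auto
  next
    assume *: "even k \<or> m mod 3 \<noteq> 2"
    obtain t :: int where "t \<ge> 1" "even (k + t * F)"
    proof (cases "even k")
      case True
      then show ?thesis by (intro that[of 2]) simp_all
    next
      case False
      then show ?thesis using * parity by (intro that[of 1]) simp_all
    qed
    moreover from this obtain e where "k + t * F = 2 * e" by blast
    ultimately show "\<exists>d e. sqrt_expansion j k d e" unfolding expansion by metis
  qed
  have B: "sqrt_expansion j k d e \<longleftrightarrow> (\<exists>l\<ge>1. e = k div 2 + l * F \<and> d = e\<^sup>2 + 2 * l * G + 1)"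
    if "even k" "odd F" for d e
  proof
    assume "sqrt_expansion j k d e"
    then obtain t where t: "t \<ge> 1" "2 * e = k + t * F" "d = e\<^sup>2 + t * G + 1"
      unfolding expansion by blast
    then have "even (k + t * F)" by (metis dvd_triv_left)
    then have "even t" using \<open>even k\<close> \<open>odd F\<close> by simp
    then obtain l where "t = 2 * l" ..
    with t \<open>even k\<close> show "\<exists>l\<ge>1. e = k div 2 + l * F \<and> d = e\<^sup>2 + 2 * l * G + 1"
      by (intro exI[of _ l]) auto
  next
    assume "\<exists>l\<ge>1. e = k div 2 + l * F \<and> d = e\<^sup>2 + 2 * l * G + 1"
    then obtain l where "l \<ge> 1" "e = k div 2 + l * F" "d = e\<^sup>2 + 2 * l * G + 1" by blast
    with \<open>even k\<close> show "sqrt_expansion j k d e"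
      unfolding expansion by (intro exI[of _ "2 * l"]) auto
  qed
  have C: "sqrt_expansion j k d e \<longleftrightarrow> (\<exists>l\<ge>1. e = k div 2 + l * (F div 2) \<and> d = e\<^sup>2 + l * G + 1)"
    if "even k" "even F" for d e
  proof -
    have "2 * e = k + l * F \<longleftrightarrow> e = k div 2 + l * (F div 2)" for l
      using that by (auto elim!: evenE simp: algebra_simps)
    then show ?thesis unfolding expansion by simp
  qed
  have D: "sqrt_expansion j k d e \<longleftrightarrow>
      (\<exists>l\<ge>0. e = (k + F) div 2 + l * F \<and> d = e\<^sup>2 + (2 * l + 1) * G + 1)"
    if "odd k" "m mod 3 \<noteq> 2" for d e
  proof -
    have "even (k + F)" using that parity by simp
    show ?thesis
    proof
      assume "sqrt_expansion j k d e"
      then obtain t where t: "t \<ge> 1" "2 * e = k + t * F" "d = e\<^sup>2 + t * G + 1"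
        unfolding expansion by blast
      then have "even (k + t * F)" by (metis dvd_triv_left)
      then have "odd t" using \<open>odd k\<close> by auto
      then obtain l where l: "t = 2 * l + 1" by (elim oddE)
      have "2 * e = (k + F) + 2 * (l * F)" using t l by (simp add: algebra_simps)
      then have "e = (k + F) div 2 + l * F" using \<open>even (k + F)\<close> by simp
      with t l show "\<exists>l\<ge>0. e = (k + F) div 2 + l * F \<and> d = e\<^sup>2 + (2 * l + 1) * G + 1"
        by (intro exI[of _ l]) auto
    next
      assume "\<exists>l\<ge>0. e = (k + F) div 2 + l * F \<and> d = e\<^sup>2 + (2 * l + 1) * G + 1"
      then obtain l where l: "l \<ge> 0" "e = (k + F) div 2 + l * F" "d = e\<^sup>2 + (2 * l + 1) * G + 1"
        by blast
      have "2 * e = (k + F) + 2 * (l * F)" using l(2) \<open>even (k + F)\<close> by simp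
      with l(1,3) show "sqrt_expansion j k d e"
        unfolding expansion by (intro exI[of _ "2 * l + 1"]) (auto simp: algebra_simps)
    qed
  qed
  have E: "is_smallest_solution d ((-1) ^ j) (F * e + G) F" if "sqrt_expansion j k d e" for d e
    using sqrt_expansion_smallest_solution[OF assms(1) m that[unfolded j]] unfolding j F G .
  show ?thesis
    unfolding F_def[symmetric] G_def[symmetric] using A B C D E by blast
qed

end
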